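(* Let $r,n$ be positive integers with $r\equiv2\pmod4$. Then $$\sum_{\pi\in A_{r,n}}q^{\ell_{\mathcal A}(\pi)}=\frac12\,[n]!_q\prod_{j=1}^n\Bigl(1+q^{j-1}\bigl(1+2q+2q^2+\cdots+2q^{\frac r2-1}\bigr)\Bigr).$$
   Context: $G_{r,n}=\mathbb{Z}_r\wr S_n$ is the set of pairs $(\vec z,\tau)$ with $\vec z=(z_1,\dots,z_n)\in\{0,\dots,r-1\}^n$, $\tau\in S_n$, with product $(\vec z,\tau)(\vec z',\tau')=((z_1+z'_{\tau^{-1}(1)},\dots,z_n+z'_{\tau^{-1}(n)}),\tau\circ\tau')$, addition mod $r$. The generator $s_0$ is the pair with vector $(1,0,\dots,0)$ and identity permutation; for $1\le i\le n-1$, $s_i$ is the pair with zero vector and transposition $(i\ i+1)$. $A_{r,n}$ is the kernel of the homomorphism $G_{r,n}\to\{\pm1\}$ sending every $s_i$, $0\le i\le n-1$, to $-1$. Put $a_0=s_0^2$, $a_i=s_0^{r/2}s_i$ for $1\le i\le n-1$, and $\mathcal A=\{a_0,a_1,a_1^{-1},a_2,\dots,a_{n-1}\}$, a generating set of $A_{r,n}$. $\ell_{\mathcal A}(\pi)$ is the minimal $u$ such that $\pi$ is a product of $u$ elements of $\mathcal A$. The factor $1+2q+\cdots+2q^{r/2-1}$ means $1+2\sum_{m=1}^{r/2-1}q^m$. Here $[k]_q=1+q+\cdots+q^{k-1}$ and $[n]!_q=[1]_q[2]_q\cdots[n]_q$. *)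

theory Defs
  imports
    "HOL-Algebra.Sym_Groups"
    "HOL-Computational_Algebra.Polynomial"
begin

(* Vectors (z_1, ..., z_n) are functions on {1..n} that take the value
   undefined elsewhere, so that the carrier is finite and equality of
   elements is equality of pairs. *)
definition colored_perm_group :: "nat \<Rightarrow> nat \<Rightarrow> ((nat \<Rightarrow> nat) \<times> (nat \<Rightarrow> nat)) monoid"
  where "colored_perm_group r n =
    \<lparr> carrier = ({1..n} \<rightarrow>\<^sub>E {0..<r}) \<times> {\<tau>. \<tau> permutes {1..n}},
      mult = (\<lambda>(z, \<tau>) (z', \<tau>'). (\<lambda>i\<in>{1..n}. (z i + z' (inv' \<tau> i)) mod r, \<tau> \<circ> \<tau>')),
      one = (\<lambda>i\<in>{1..n}. 0, id) \<rparr>"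

definition s_gen :: "nat \<Rightarrow> nat \<Rightarrow> (nat \<Rightarrow> nat) \<times> (nat \<Rightarrow> nat)"
  where "s_gen n i =
    (if i = 0 then (\<lambda>k\<in>{1..n}. if k = 1 then 1 else 0, id)
     else (\<lambda>k\<in>{1..n}. 0, transpose i (i + 1)))"

(* The homomorphism to {1, -1} that sends every s_i to -1. It exists for even r.
   Homomorphisms in HOL-Algebra are constrained on the carrier only, so
   extensionality is what makes the function unique. *)
definition sign_char :: "nat \<Rightarrow> nat \<Rightarrow> (nat \<Rightarrow> nat) \<times> (nat \<Rightarrow> nat) \<Rightarrow> int"
  where "sign_char r n =
    (THE \<chi>. \<chi> \<in> hom (colored_perm_group r n) sign_img
          \<and> \<chi> \<in> extensional (carrier (colored_perm_group r n))
          \<and> (\<forall>i<n. \<chi> (s_gen n i) = -1))"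

definition alt_colored_perms :: "nat \<Rightarrow> nat \<Rightarrow> ((nat \<Rightarrow> nat) \<times> (nat \<Rightarrow> nat)) set"
  where "alt_colored_perms r n = kernel (colored_perm_group r n) sign_img (sign_char r n)"

definition a_gen :: "nat \<Rightarrow> nat \<Rightarrow> nat \<Rightarrow> (nat \<Rightarrow> nat) \<times> (nat \<Rightarrow> nat)"
  where "a_gen r n i =
    (if i = 0 then s_gen n 0 [^]\<^bsub>colored_perm_group r n\<^esub> (2::nat)
     else s_gen n 0 [^]\<^bsub>colored_perm_group r n\<^esub> (r div 2)
            \<otimes>\<^bsub>colored_perm_group r n\<^esub> s_gen n i)"

(* Of the inverses only that of a_1 is a generator; for n = 1 there is no a_1
   and the set is {a_0}. *)
definition alt_gens :: "nat \<Rightarrow> nat \<Rightarrow> ((nat \<Rightarrow> nat) \<times> (nat \<Rightarrow> nat)) set"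
  where "alt_gens r n =
    {a_gen r n i | i. i < n}
    \<union> (if 1 < n then {inv\<^bsub>colored_perm_group r n\<^esub> (a_gen r n 1)} else {})"

definition alt_length :: "nat \<Rightarrow> nat \<Rightarrow> (nat \<Rightarrow> nat) \<times> (nat \<Rightarrow> nat) \<Rightarrow> nat"
  where "alt_length r n \<pi> =
    (LEAST u. \<exists>ws. length ws = u \<and> set ws \<subseteq> alt_gens r n
        \<and> foldr (\<otimes>\<^bsub>colored_perm_group r n\<^esub>) ws \<one>\<^bsub>colored_perm_group r n\<^esub> = \<pi>)"

definition q_var :: "rat poly"
  where "q_var = [:0, 1:]"

definition q_int :: "nat \<Rightarrow> rat poly"
  where "q_int k = (\<Sum>i<k. q_var ^ i)"

definition q_fact :: "nat \<Rightarrow> rat poly"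
  where "q_fact n = (\<Prod>k=1..n. q_int k)"

end

theory Submission
  imports Defs "HOL-Combinatorics.Multiset_Permutations"
begin

text \<open>
  Write \<open>r = 2h\<close> with \<open>h\<close> odd and \<open>t = s\<^sub>0\<^sup>h\<close>. View \<open>(z, \<tau>)\<close> as the word whose \<open>j\<close>-th letter is the value
  \<open>\<tau>\<^sup>-\<^sup>1(j)\<close> with color \<open>z\<^sub>j\<close>: left multiplication by \<open>s\<^sub>i\<close> swaps adjacent letters and left multiplication
  by \<open>s\<^sub>0\<close> recolors the first letter. The length of an element of the alternating subgroup turns out to be
  its length in the whole group when \<open>t\<close> costs 0 and \<open>s\<^sub>0\<^sup>2, s\<^sub>1, \<dots>, s\<^sub>n\<^sub>-\<^sub>1\<close> cost 1 each: the generators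
  \<open>a\<^sub>1 = t s\<^sub>1\<close> and \<open>a\<^sub>1\<^sup>-\<^sup>1 = s\<^sub>1 t\<close> allow one to place \<open>t\<close> on either side of \<open>s\<^sub>1\<close>, while \<open>t\<close> commutes with
  the other \<open>s\<^sub>i\<close>. This weighted length has an explicit formula in the manner of signed permutations, whose
  generating function over the whole group factors; since multiplication by \<open>t\<close> preserves it and exchanges
  the two cosets of the alternating subgroup, the sum over the subgroup is half of that product.
\<close>

section \<open>Inversions\<close>

fun inversions :: "'a :: linorder list \<Rightarrow> nat" where
  "inversions [] = 0"
| "inversions (x # xs) = length (filter (\<lambda>y. y < x) xs) + inversions xs"

text \<open>Each of the two letters keeps its order relative to every other letter, so only the pair
  itself changes status.\<close>

lemma inversions_swap:
  "a < b \<Longrightarrow> inversions (xs @ b # a # ys) = Suc (inversions (xs @ a # b # ys))"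
  by (induction xs) auto

lemma upt_split_adjacent:
  assumes "1 \<le> i" "i < n"
  shows "[1..<Suc n] = [1..<i] @ i # Suc i # [i + 2..<Suc n]"
proof -
  have "[1..<Suc n] = [1..<i] @ [i..<Suc n]"
    using upt_add_eq_append[of 1 i "Suc n - i"] assms by simp
  also have "[i..<Suc n] = i # Suc i # [i + 2..<Suc n]"
    using assms by (simp add: upt_conv_Cons del: upt_Suc)
  finally show ?thesis .
qed

lemma inversions_transpose:
  fixes k :: "nat \<Rightarrow> 'a :: linorder"
  assumes i: "1 \<le> i" "i < n" and less: "k i < k (Suc i)"
  shows "inversions (map (k \<circ> transpose i (Suc i)) [1..<Suc n]) = Suc (inversions (map k [1..<Suc n]))"
proof -
  have "map (k \<circ> transpose i (Suc i)) [1..<i] = map k [1..<i]"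
    and "map (k \<circ> transpose i (Suc i)) [i + 2..<Suc n] = map k [i + 2..<Suc n]"
    by (auto simp: transpose_def)
  then have "map (k \<circ> transpose i (Suc i)) [1..<Suc n]
      = map k [1..<i] @ k (Suc i) # k i # map k [i + 2..<Suc n]"
    unfolding upt_split_adjacent[OF i] by (simp del: upt_Suc)
  moreover have "map k [1..<Suc n] = map k [1..<i] @ k i # k (Suc i) # map k [i + 2..<Suc n]"
    unfolding upt_split_adjacent[OF i] by simp
  ultimately show ?thesis
    using inversions_swap[OF less] by metis
qed

text \<open>The exponents are the ranks in \<open>A\<close>, which run through
  \<open>0, ..., card A - 1\<close>. Inserting a new maximum leaves the old ranks alone and adds the
  rank \<open>card A\<close>.\<close>

lemma sum_power_card_less:
  fixes A :: "'a :: linorder set"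
  assumes "finite A"
  shows "(\<Sum>x\<in>A. q_var ^ card {y \<in> A. y < x}) = q_int (card A)"
  using assms
proof (induction rule: finite_linorder_max_induct)
  case empty
  then show ?case by (simp add: q_int_def)
next
  case (insert b A)
  have "{y \<in> insert b A. y < x} = {y \<in> A. y < x}" if "x \<in> A" for x
    using insert.hyps(2) that by fastforce
  moreover have "{y \<in> insert b A. y < b} = A"
    using insert.hyps(2) by auto
  moreover have "b \<notin> A"
    using insert.hyps(2) by blast
  ultimately show ?case
    using insert by (simp add: q_int_def)
qed

text \<open>Split by the first letter \<open>x\<close>: it contributes its rank in \<open>A\<close>,
  and the remaining letters form an arbitrary arrangement of \<open>A - {x}\<close>. A general
  linear order is allowed because the lemma is later applied to sets of integer keys of mixed
  sign.\<close>

lemma inversions_generating_function: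
  fixes A :: "'a :: linorder set"
  assumes "finite A"
  shows "(\<Sum>xs\<in>permutations_of_set A. q_var ^ inversions xs) = q_fact (card A)"
  using assms
proof (induction "card A" arbitrary: A)
  case 0
  then show ?case by (simp add: q_fact_def)
next
  case (Suc m)
  have less: "length (filter (\<lambda>y. y < x) xs) = card {y \<in> A. y < x}"
    if "xs \<in> permutations_of_set (A - {x})" for x xs
  proof -
    have "{y. y < x} \<inter> set xs = {y \<in> A. y < x}"
      using permutations_of_setD(1)[OF that] by auto
    then show ?thesis
      using permutations_of_setD(2)[OF that] by (simp add: distinct_length_filter)
  qed
  have "A \<noteq> {}"
    using Suc.hyps(2) by auto
  then have "(\<Sum>xs\<in>permutations_of_set A. q_var ^ inversions xs)
      = (\<Sum>xs\<in>(\<Union>x\<in>A. (#) x ` permutations_of_set (A - {x})). q_var ^ inversions xs)"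
    by (simp add: permutations_of_set_nonempty)
  also have "\<dots> = (\<Sum>x\<in>A. \<Sum>xs\<in>(#) x ` permutations_of_set (A - {x}). q_var ^ inversions xs)"
    by (rule sum.UNION_disjoint) (use Suc.prems in auto)
  also have "\<dots> = (\<Sum>x\<in>A. \<Sum>xs\<in>permutations_of_set (A - {x}). q_var ^ inversions (x # xs))"
    by (rule sum.cong[OF refl]) (simp add: sum.reindex)
  also have "\<dots> = (\<Sum>x\<in>A. q_var ^ card {y \<in> A. y < x} *
      (\<Sum>xs\<in>permutations_of_set (A - {x}). q_var ^ inversions xs))"
    by (simp add: less power_add sum_distrib_left)
  also have "\<dots> = (\<Sum>x\<in>A. q_var ^ card {y \<in> A. y < x} * q_fact m)"
  proof (intro sum.cong refl)
    fix x assume "x \<in> A"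
    then have "m = card (A - {x})"
      using Suc by simp
    then show "q_var ^ card {y \<in> A. y < x} * (\<Sum>xs\<in>permutations_of_set (A - {x}). q_var ^ inversions xs)
        = q_var ^ card {y \<in> A. y < x} * q_fact m"
      using Suc.hyps(1)[of "A - {x}"] Suc.prems by simp
  qed
  also have "\<dots> = q_int (card A) * q_fact m"
    using sum_power_card_less[OF Suc.prems] by (simp flip: sum_distrib_right)
  finally show ?case
    by (simp add: q_fact_def mult.commute flip: Suc.hyps(2))
qed

text \<open>Turns a sum over permutations of positions into a sum over arrangements of the
  keys.\<close>

lemma bij_betw_permutes_permutations_of_set:
  assumes inj: "inj_on k {1..n}"
  shows "bij_betw (\<lambda>\<sigma>. map (k \<circ> \<sigma>) [1..<Suc n]) {\<sigma>. \<sigma> permutes {1..n}} (permutations_of_set (k ` {1..n}))"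
    (is "bij_betw ?F ?P ?L")
proof -
  have inj_F: "inj_on ?F ?P"
  proof (rule inj_onI)
    fix \<sigma> \<tau>
    assume *: "\<sigma> \<in> ?P" "\<tau> \<in> ?P" "?F \<sigma> = ?F \<tau>"
    have "\<sigma> x = \<tau> x" for x
    proof (cases "x \<in> {1..n}")
      case True
      then have "k (\<sigma> x) = k (\<tau> x)"
        using *(3) by (simp del: upt_Suc)
      moreover have "\<sigma> x \<in> {1..n}" "\<tau> x \<in> {1..n}"
        using *(1,2) True permutes_in_image by (metis mem_Collect_eq)+
      ultimately show ?thesis
        using inj by (simp add: inj_on_eq_iff)
    next
      case False
      then show ?thesis
        using *(1,2) by (simp add: permutes_not_in)
    qed
    then show "\<sigma> = \<tau>" by blast
  qed
  have "?F ` ?P \<subseteq> ?L"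
  proof clarify
    fix \<sigma> assume \<sigma>: "\<sigma> permutes {1..n}"
    have *: "set [1..<Suc n] = {1..n}" by (simp add: atLeastLessThanSuc_atLeastAtMost del: upt_Suc)
    have "inj_on (k \<circ> \<sigma>) {1..n}"
      using permutes_inj_on[OF \<sigma>] permutes_image[OF \<sigma>] inj by (simp add: comp_inj_on)
    moreover have "(k \<circ> \<sigma>) ` {1..n} = k ` {1..n}"
      using permutes_image[OF \<sigma>] by (simp only: image_comp[symmetric])
    ultimately show "?F \<sigma> \<in> ?L"
      by (intro permutations_of_setI) (simp_all only: distinct_map * set_map distinct_upt simp_thms)
  qed
  \<comment> \<open>Surjectivity follows by counting: both sets have \<open>fact n\<close>
    elements.\<close>
  moreover have "card (?F ` ?P) = card ?L"
    using inj_F inj by (simp add: card_image card_permutations[OF refl])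
  ultimately have "?F ` ?P = ?L"
    by (intro card_subset_eq) auto
  then show ?thesis
    using inj_F by (simp add: bij_betw_def)
qed

section \<open>The colored permutation group\<close>

text \<open>Residues modulo \<open>r = 2h\<close>, with \<open>h\<close> odd, are pairs of residues modulo 2 and modulo \<open>h\<close>.
  The cost forgets the first component and halves the second one: it counts the factors
  \<open>s\<^sub>0\<^sup>2\<close> needed, while \<open>s\<^sub>0\<^sup>h\<close> is free.\<close>

definition color_cost :: "nat \<Rightarrow> nat \<Rightarrow> nat" where
  "color_cost r c = c * ((r div 2 + 1) div 2) mod (r div 2)"

text \<open>Colored letters precede the uncolored ones, in decreasing order of their values.\<close>

definition entry_key :: "(nat \<Rightarrow> nat) \<times> (nat \<Rightarrow> nat) \<Rightarrow> nat \<Rightarrow> int" where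
  "entry_key = (\<lambda>(z, \<tau>) j. if z j = 0 then int (inv' \<tau> j) else - int (inv' \<tau> j))"

text \<open>For \<open>r = 2\<close> the color costs vanish and this is the type B length with the
  generator \<open>s_0\<close> counted as 0: inversions plus absolute values of the negative
  letters, less 1 for each of them.\<close>

definition weighted_length :: "nat \<Rightarrow> nat \<Rightarrow> (nat \<Rightarrow> nat) \<times> (nat \<Rightarrow> nat) \<Rightarrow> nat" where
  "weighted_length r n g = inversions (map (entry_key g) [1..<Suc n])
    + (\<Sum>j=1..n. if fst g j = 0 then 0 else inv' (snd g) j - 1)
    + (\<Sum>j=1..n. color_cost r (fst g j))"

text \<open>The explicit candidate for the character that \<open>sign_char\<close> specifies only by
  its properties.\<close>

definition color_sign :: "nat \<Rightarrow> (nat \<Rightarrow> nat) \<times> (nat \<Rightarrow> nat) \<Rightarrow> int" where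
  "color_sign n = (\<lambda>(z, \<tau>). (-1) ^ (\<Sum>j=1..n. z j) * sign \<tau>)"

locale alternating_colored_perms =
  fixes r n :: nat
  assumes n_pos: "0 < n" and r_mod_4: "r mod 4 = 2"
begin

abbreviation G where "G \<equiv> colored_perm_group r n"

abbreviation half_turn where "half_turn \<equiv> s_gen n 0 [^]\<^bsub>G\<^esub> (r div 2)"

lemma r_eq: "r = 2 * (r div 2)"
  using r_mod_4 by presburger

lemma odd_half: "odd (r div 2)"
  using r_mod_4 by presburger

lemma half_pos: "0 < r div 2"
  using odd_half odd_pos by blast

lemma r_ge_2: "2 \<le> r"
  using r_eq half_pos by linarith

section \<open>Group axioms for the colored permutations\<close>

lemma carrier_iff: "(z, \<tau>) \<in> carrier G \<longleftrightarrow> z \<in> {1..n} \<rightarrow>\<^sub>E {0..<r} \<and> \<tau> permutes {1..n}"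
  by (simp add: colored_perm_group_def)

lemma mult_eq: "(z, \<tau>) \<otimes>\<^bsub>G\<^esub> (z', \<tau>') = (\<lambda>i\<in>{1..n}. (z i + z' (inv' \<tau> i)) mod r, \<tau> \<circ> \<tau>')"
  by (simp add: colored_perm_group_def)

lemma one_eq: "\<one>\<^bsub>G\<^esub> = (\<lambda>i\<in>{1..n}. 0, id)"
  by (simp add: colored_perm_group_def)

lemma finite_carrier: "finite (carrier G)"
  by (simp add: colored_perm_group_def finite_PiE finite_permutations)

lemma mult_closed: "g \<in> carrier G \<Longrightarrow> g' \<in> carrier G \<Longrightarrow> g \<otimes>\<^bsub>G\<^esub> g' \<in> carrier G"
  using r_ge_2 by (cases g; cases g') (auto simp: carrier_iff mult_eq permutes_compose)

lemma one_closed: "\<one>\<^bsub>G\<^esub> \<in> carrier G"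
  using r_ge_2 by (auto simp: one_eq carrier_iff)

lemma inv_mem: "\<tau> permutes {1..n} \<Longrightarrow> inv' \<tau> i \<in> {1..n} \<longleftrightarrow> i \<in> {1..n}"
  using permutes_in_image permutes_inv by metis

lemma mult_assoc:
  assumes "g \<in> carrier G" "g' \<in> carrier G" "g'' \<in> carrier G"
  shows "g \<otimes>\<^bsub>G\<^esub> g' \<otimes>\<^bsub>G\<^esub> g'' = g \<otimes>\<^bsub>G\<^esub> (g' \<otimes>\<^bsub>G\<^esub> g'')"
proof -
  obtain z \<tau> z' \<tau>' z'' \<tau>'' where g: "g = (z, \<tau>)" "g' = (z', \<tau>')" "g'' = (z'', \<tau>'')"
    by (metis surj_pair)
  have \<tau>: "\<tau> permutes {1..n}" "\<tau>' permutes {1..n}"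
    using assms g by (auto simp: carrier_iff)
  have "inv' (\<tau> \<circ> \<tau>') = inv' \<tau>' \<circ> inv' \<tau>"
    using \<tau> by (meson o_inv_distrib permutes_bij)
  moreover have "inv' \<tau> i \<in> {1..n}" if "i \<in> {1..n}" for i
    using that \<tau> inv_mem by blast
  ultimately show ?thesis
    unfolding g mult_eq prod.inject
    by (intro conjI restrict_ext) (simp_all add: mod_simps add.assoc comp_assoc)
qed

lemma one_mult:
  assumes "g \<in> carrier G"
  shows "\<one>\<^bsub>G\<^esub> \<otimes>\<^bsub>G\<^esub> g = g"
proof -
  obtain z \<tau> where g: "g = (z, \<tau>)" by fastforce
  then have z: "z \<in> {1..n} \<rightarrow>\<^sub>E {0..<r}"
    using assms by (simp add: carrier_iff)
  have "z i < r" if "i \<in> {1..n}" for i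
    using PiE_mem[OF z that] by simp
  then have "(\<lambda>i\<in>{1..n}. z i mod r) = restrict z {1..n}"
    by (intro restrict_ext) simp
  then have "(\<lambda>i\<in>{1..n}. z i mod r) = z"
    using z by simp
  then show ?thesis
    by (simp add: g one_eq mult_eq cong: restrict_cong del: atLeastAtMost_iff)
qed

lemma left_inverse_exists:
  assumes "g \<in> carrier G"
  shows "\<exists>g'\<in>carrier G. g' \<otimes>\<^bsub>G\<^esub> g = \<one>\<^bsub>G\<^esub>"
proof -
  obtain z \<tau> where g: "g = (z, \<tau>)" by fastforce
  then have z: "z \<in> {1..n} \<rightarrow>\<^sub>E {0..<r}" and \<tau>: "\<tau> permutes {1..n}"
    using assms by (simp_all add: carrier_iff)
  \<comment> \<open>Since \<open>inv' (inv' \<tau>) = \<tau>\<close>, position \<open>i\<close> of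
    the product \<open>g' g\<close> receives the color \<open>z (\<tau> i)\<close>, which has to be
    cancelled. The outer \<open>mod r\<close> handles color 0.\<close>
  define g' where "g' = (\<lambda>i\<in>{1..n}. (r - z (\<tau> i)) mod r, inv' \<tau>)"
  have "g' \<in> carrier G"
    using r_ge_2 permutes_inv[OF \<tau>] by (auto simp: g'_def carrier_iff)
  moreover have "g' \<otimes>\<^bsub>G\<^esub> g = \<one>\<^bsub>G\<^esub>"
  proof -
    have "((r - z (\<tau> i)) mod r + z (\<tau> i)) mod r = 0" if "i \<in> {1..n}" for i
    proof -
      have "\<tau> i \<in> {1..n}"
        using that \<tau> permutes_in_image by metis
      then have "z (\<tau> i) < r"
        using z by auto
      then show ?thesis by (simp add: mod_simps)
    qed
    then show ?thesis
      unfolding g g'_def mult_eq one_eq permutes_inv_inv[OF \<tau>] permutes_inv_o(2)[OF \<tau>]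
      by (simp cong: restrict_cong)
  qed
  ultimately show ?thesis by blast
qed

sublocale group G
  by (rule groupI; rule mult_closed one_closed mult_assoc one_mult left_inverse_exists; assumption)

lemma s_gen_closed: "i < n \<Longrightarrow> s_gen n i \<in> carrier G"
  using r_ge_2 by (auto simp: s_gen_def carrier_iff intro!: permutes_swap_id)

section \<open>Left multiplication by rotations and adjacent swaps\<close>

lemma rotation_eq:
  "s_gen n 0 [^]\<^bsub>G\<^esub> (k :: nat) = (\<lambda>j\<in>{1..n}. if j = 1 then k mod r else 0, id)"
proof (induction k)
  case 0
  then show ?case
    unfolding nat_pow_0 one_eq prod.inject by (intro conjI restrict_ext) simp_all
next
  case (Suc k)
  then show ?case
    unfolding nat_pow_Suc Suc unfolding s_gen_def if_P[OF refl] mult_eq prod.inject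
    by (intro conjI restrict_ext) (simp_all add: mod_simps)
qed

lemma rotation_mult:
  assumes "(z, \<tau>) \<in> carrier G"
  shows "s_gen n 0 [^]\<^bsub>G\<^esub> (k :: nat) \<otimes>\<^bsub>G\<^esub> (z, \<tau>) = (z(1 := (z 1 + k) mod r), \<tau>)"
proof -
  have z: "z \<in> {1..n} \<rightarrow>\<^sub>E {0..<r}"
    using assms by (simp add: carrier_iff)
  have eq: "(\<lambda>j\<in>{1..n}. ((if j = 1 then k mod r else 0) + z j) mod r) j = (z(1 := (z 1 + k) mod r)) j" for j
  proof (cases "j \<in> {1..n}")
    case True
    then have "z j < r"
      using PiE_mem[OF z True] by simp
    then show ?thesis
      using True by (simp add: mod_simps add.commute)
  next
    \<comment> \<open>Outside \<open>{1..n}\<close> both sides are \<open>undefined\<close>; by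
      \<open>n_pos\<close> the updated position 1 lies inside.\<close>
    case False
    then show ?thesis
      using n_pos PiE_arb[OF z False] by (auto simp: restrict_def)
  qed
  have "s_gen n 0 [^]\<^bsub>G\<^esub> k \<otimes>\<^bsub>G\<^esub> (z, \<tau>) = (\<lambda>j\<in>{1..n}. ((if j = 1 then k mod r else 0) + z j) mod r, \<tau>)"
    unfolding rotation_eq mult_eq prod.inject by (intro conjI restrict_ext) simp_all
  also have "\<dots> = (z(1 := (z 1 + k) mod r), \<tau>)"
    unfolding prod.inject by (intro conjI ext eq refl)
  finally show ?thesis .
qed

lemma swap_mult:
  assumes "(z, \<tau>) \<in> carrier G" and i: "1 \<le> i" "i < n"
  shows "s_gen n i \<otimes>\<^bsub>G\<^esub> (z, \<tau>) = (z \<circ> transpose i (Suc i), transpose i (Suc i) \<circ> \<tau>)"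
proof -
  have z: "z \<in> {1..n} \<rightarrow>\<^sub>E {0..<r}"
    using assms by (simp add: carrier_iff)
  have eq: "(\<lambda>j\<in>{1..n}. z (transpose i (Suc i) j) mod r) j = (z \<circ> transpose i (Suc i)) j" for j
  proof (cases "j \<in> {1..n}")
    case True
    then have "transpose i (Suc i) j \<in> {1..n}"
      using i by (auto simp: transpose_def)
    then have "z (transpose i (Suc i) j) < r"
      using PiE_mem[OF z] by fastforce
    then show ?thesis
      using True by simp
  next
    case False
    then have "transpose i (Suc i) j = j"
      using i by (auto simp: transpose_def)
    then show ?thesis
      using PiE_arb[OF z False] False by (simp only: restrict_apply if_False comp_apply)
  qed
  have "s_gen n i \<otimes>\<^bsub>G\<^esub> (z, \<tau>) = (\<lambda>j\<in>{1..n}. z (transpose i (Suc i) j) mod r, transpose i (Suc i) \<circ> \<tau>)"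
    using i by (auto simp: s_gen_def mult_eq intro!: restrict_ext)
  also have "\<dots> = (z \<circ> transpose i (Suc i), transpose i (Suc i) \<circ> \<tau>)"
    unfolding prod.inject by (intro conjI ext eq refl)
  finally show ?thesis .
qed

section \<open>Weighted length under adjacent swaps and recoloring\<close>

lemma inv_perm_bounds:
  assumes "(z, \<tau>) \<in> carrier G" "j \<in> {1..n}"
  shows "1 \<le> inv' \<tau> j" "inv' \<tau> j \<le> n"
  using assms inv_mem[of \<tau> j] by (auto simp: carrier_iff)

lemma inv_perm_eq_iff:
  assumes "(z, \<tau>) \<in> carrier G"
  shows "inv' \<tau> i = inv' \<tau> j \<longleftrightarrow> i = j"
  using assms permutes_inj[OF permutes_inv, of \<tau> "{1..n}"] by (simp add: carrier_iff inj_eq)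

text \<open>Letters are distinct and at least 1, so their signed versions cannot coincide
  either.\<close>

lemma entry_key_neq:
  assumes "(z, \<tau>) \<in> carrier G" "i \<in> {1..n}" "j \<in> {1..n}" "i \<noteq> j"
  shows "entry_key (z, \<tau>) i \<noteq> entry_key (z, \<tau>) j"
  using inv_perm_bounds[OF assms(1,2)] inv_perm_bounds[OF assms(1,3)] inv_perm_eq_iff[OF assms(1)] assms(4)
  by (auto simp: entry_key_def)

text \<open>Letters move together with their colors, so the two sums over positions are merely
  reordered and only the inversions change.\<close>

lemma weighted_length_swap:
  assumes g: "g \<in> carrier G" and i: "1 \<le> i" "i < n"
    and less: "entry_key g i < entry_key g (Suc i)"
  shows "weighted_length r n (s_gen n i \<otimes>\<^bsub>G\<^esub> g) = Suc (weighted_length r n g)"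
proof -
  obtain z \<tau> where g_eq: "g = (z, \<tau>)" by fastforce
  let ?t = "transpose i (Suc i)"
  have t: "?t permutes {1..n}"
    using i by (auto intro: permutes_swap_id)
  have "bij \<tau>"
    using g permutes_bij by (auto simp: g_eq carrier_iff)
  then have inv_eq: "inv' (?t \<circ> \<tau>) = inv' \<tau> \<circ> ?t"
    by (simp add: o_inv_distrib)
  have "entry_key (z \<circ> ?t, ?t \<circ> \<tau>) = entry_key g \<circ> ?t"
    by (simp add: g_eq entry_key_def inv_eq fun_eq_iff)
  moreover have "(\<Sum>j=1..n. F (?t j)) = (\<Sum>j=1..n. F j)" for F :: "nat \<Rightarrow> nat"
    using sum.permute[OF t, of F] by (simp add: comp_def)
  note this[of "\<lambda>j. if z j = 0 then 0 else inv' \<tau> j - 1"] this[of "\<lambda>j. color_cost r (z j)"]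
  ultimately show ?thesis
    using inversions_transpose[OF i less]
    unfolding weighted_length_def g_eq swap_mult[OF g[unfolded g_eq] i] fst_conv snd_conv inv_eq comp_apply
    by simp
qed

lemma swap_closed:
  assumes "g \<in> carrier G" "i < n"
  shows "s_gen n i \<otimes>\<^bsub>G\<^esub> g \<in> carrier G"
  using assms s_gen_closed by blast

lemma swap_swap:
  assumes "g \<in> carrier G" "1 \<le> i" "i < n"
  shows "s_gen n i \<otimes>\<^bsub>G\<^esub> (s_gen n i \<otimes>\<^bsub>G\<^esub> g) = g"
proof -
  obtain z \<tau> where g_eq: "g = (z, \<tau>)" by fastforce
  show ?thesis
    using swap_closed[OF assms(1,3)] assms
    by (simp add: g_eq swap_mult comp_assoc) (simp flip: comp_assoc)
qed

text \<open>A descent of \<open>g\<close> at \<open>i\<close> is an ascent of \<open>s_i g\<close>,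
  and \<open>s_i\<close> is an involution.\<close>

lemma weighted_length_swap_descent:
  assumes g: "g \<in> carrier G" and i: "1 \<le> i" "i < n"
    and less: "entry_key g (Suc i) < entry_key g i"
  shows "weighted_length r n g = Suc (weighted_length r n (s_gen n i \<otimes>\<^bsub>G\<^esub> g))"
proof -
  obtain z \<tau> where g_eq: "g = (z, \<tau>)" by fastforce
  let ?t = "transpose i (Suc i)"
  have "bij \<tau>"
    using g permutes_bij by (auto simp: g_eq carrier_iff)
  then have "inv' (?t \<circ> \<tau>) = inv' \<tau> \<circ> ?t"
    by (simp add: o_inv_distrib)
  then have "entry_key (s_gen n i \<otimes>\<^bsub>G\<^esub> g) = entry_key g \<circ> ?t"
    using swap_mult[OF g[unfolded g_eq] i] by (simp add: g_eq entry_key_def fun_eq_iff)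
  then have "entry_key (s_gen n i \<otimes>\<^bsub>G\<^esub> g) i < entry_key (s_gen n i \<otimes>\<^bsub>G\<^esub> g) (Suc i)"
    using less by simp
  from weighted_length_swap[OF swap_closed[OF g i(2)] i this] swap_swap[OF g i]
  show ?thesis by simp
qed

lemma weighted_length_swap_cases:
  assumes g: "g \<in> carrier G" and i: "1 \<le> i" "i < n"
  shows "weighted_length r n (s_gen n i \<otimes>\<^bsub>G\<^esub> g) = Suc (weighted_length r n g)
    \<or> weighted_length r n g = Suc (weighted_length r n (s_gen n i \<otimes>\<^bsub>G\<^esub> g))"
proof -
  have "entry_key g i \<noteq> entry_key g (Suc i)"
    using entry_key_neq[of "fst g" "snd g" i "Suc i"] g i by simp
  then show ?thesis
    using weighted_length_swap[OF assms] weighted_length_swap_descent[OF assms] by linarith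
qed

text \<open>The right-hand side depends on the first color only through its cost: coloring a first letter of
  value \<open>v\<close> removes its inversions with the \<open>v - 1\<close> smaller values, at a price of \<open>v - 1\<close>.\<close>

lemma weighted_length_first_entry:
  assumes g: "(z, \<tau>) \<in> carrier G"
  shows "weighted_length r n (z, \<tau>) =
    card {j \<in> {2..n}. entry_key (z, \<tau>) j < int (inv' \<tau> 1)}
    + inversions (map (entry_key (z, \<tau>)) [2..<Suc n])
    + (\<Sum>j=2..n. if z j = 0 then 0 else inv' \<tau> j - 1)
    + (\<Sum>j=2..n. color_cost r (z j)) + color_cost r (z 1)"
proof -
  let ?k = "entry_key (z, \<tau>)" and ?v = "inv' \<tau>"
  have upt: "[1..<Suc n] = 1 # [2..<Suc n]"
    using n_pos by (simp add: upt_conv_Cons numeral_2_eq_2 del: upt_Suc)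
  have split: "(\<Sum>j=1..n. F j) = F 1 + (\<Sum>j=2..n. F j)" for F :: "nat \<Rightarrow> nat"
    using n_pos by (simp add: sum.atLeast_Suc_atMost numeral_2_eq_2)
  have filter: "length (filter P (map ?k [2..<Suc n])) = card {j \<in> {2..n}. P (?k j)}" for P
  proof -
    have "length (filter P (map ?k [2..<Suc n])) = card ({j. P (?k j)} \<inter> set [2..<Suc n])"
      by (simp add: filter_map distinct_length_filter comp_def del: upt_Suc)
    also have "{j. P (?k j)} \<inter> set [2..<Suc n] = {j \<in> {2..n}. P (?k j)}"
      by auto
    finally show ?thesis .
  qed
  have first: "card {j \<in> {2..n}. ?k j < ?k 1} + (if z 1 = 0 then 0 else ?v 1 - 1)
      = card {j \<in> {2..n}. ?k j < int (?v 1)}"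
  proof (cases "z 1 = 0")
    case True
    then show ?thesis by (simp add: entry_key_def)
  next
    case False
    have v: "?v permutes {1..n}"
      using g permutes_inv by (auto simp: carrier_iff)
    have ne: "?v j \<noteq> ?v 1" if "j \<in> {2..n}" for j
      using that inv_perm_eq_iff[OF g] by auto
    have v1: "1 \<le> ?v 1" "?v 1 \<le> n"
      using inv_perm_bounds[OF g, of 1] n_pos by auto
    \<comment> \<open>All values below the first letter occur at later positions, so there are
      exactly \<open>?v 1 - 1\<close> of them.\<close>
    have "?v ` {j \<in> {2..n}. ?v j < ?v 1} = {1..<?v 1}"
    proof (intro equalityI subsetI)
      fix m assume "m \<in> ?v ` {j \<in> {2..n}. ?v j < ?v 1}"
      then show "m \<in> {1..<?v 1}"
        using inv_perm_bounds(1)[OF g] by auto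
    next
      fix m assume m: "m \<in> {1..<?v 1}"
      then have "m \<in> ?v ` {1..n}"
        using permutes_image[OF v] v1 by auto
      then obtain j where j: "j \<in> {1..n}" "m = ?v j" by blast
      then have "j \<noteq> 1"
        using m by auto
      then have "j \<in> {2..n}"
        using j(1) by auto
      then show "m \<in> ?v ` {j \<in> {2..n}. ?v j < ?v 1}"
        using j m by auto
    qed
    moreover have "inj_on ?v {j \<in> {2..n}. ?v j < ?v 1}"
      using permutes_inj_on[OF v] by blast
    ultimately have card: "card {j \<in> {2..n}. ?v j < ?v 1} = ?v 1 - 1"
      by (metis card_atLeastLessThan card_image)
    \<comment> \<open>Here \<open>?k 1 = - ?v 1\<close>. A key below \<open>?v 1\<close> either has
      absolute value below \<open>?v 1\<close> or lies below \<open>- ?v 1\<close>, and never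
      both.\<close>
    have "?k j < int (?v 1) \<longleftrightarrow> ?k j < ?k 1 \<or> ?v j < ?v 1" 
      and "\<not> (?k j < ?k 1 \<and> ?v j < ?v 1)" if "j \<in> {2..n}" for j
      using ne[OF that] False v1 by (auto simp: entry_key_def)
    then have "{j \<in> {2..n}. ?k j < int (?v 1)} = {j \<in> {2..n}. ?k j < ?k 1} \<union> {j \<in> {2..n}. ?v j < ?v 1}"
      and "{j \<in> {2..n}. ?k j < ?k 1} \<inter> {j \<in> {2..n}. ?v j < ?v 1} = {}"
      by blast+
    then have "card {j \<in> {2..n}. ?k j < int (?v 1)}
        = card {j \<in> {2..n}. ?k j < ?k 1} + card {j \<in> {2..n}. ?v j < ?v 1}"
      by (simp add: card_Un_disjoint)
    then show ?thesis
      using False card by simp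
  qed
  show ?thesis
    unfolding weighted_length_def upt list.map inversions.simps filter split fst_conv snd_conv
    using first by linarith
qed

text \<open>In the formula by first entry only the last summand involves the first color. The
  additive form avoids subtraction of natural numbers.\<close>

lemma weighted_length_recolor:
  assumes g: "(z, \<tau>) \<in> carrier G" and c: "c < r"
  shows "weighted_length r n (z(1 := c), \<tau>) + color_cost r (z 1) = weighted_length r n (z, \<tau>) + color_cost r c"
proof -
  have g': "(z(1 := c), \<tau>) \<in> carrier G"
    using g c n_pos by (auto simp: carrier_iff PiE_iff extensional_def)
  have key: "entry_key (z(1 := c), \<tau>) j = entry_key (z, \<tau>) j" if "j \<in> {2..n}" for j
    using that by (simp add: entry_key_def)
  have "{j \<in> {2..n}. entry_key (z(1 := c), \<tau>) j < x} = {j \<in> {2..n}. entry_key (z, \<tau>) j < x}" for x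
    using key by auto
  moreover have map_eq: "map (entry_key (z(1 := c), \<tau>)) [2..<Suc n] = map (entry_key (z, \<tau>)) [2..<Suc n]"
    using key by (intro map_cong refl) (simp del: upt_Suc)
  moreover have "(\<Sum>j=2..n. F ((z(1 := c)) j) j) = (\<Sum>j=2..n. F (z j) j)" for F :: "nat \<Rightarrow> nat \<Rightarrow> nat"
    by (intro sum.cong refl) auto
  note this[of "\<lambda>x j. if x = 0 then 0 else inv' \<tau> j - 1"] this[of "\<lambda>x j. color_cost r x"]
  ultimately show ?thesis
    unfolding weighted_length_first_entry[OF g] weighted_length_first_entry[OF g'] map_eq
    by simp
qed

section \<open>Arithmetic of the color cost\<close>

lemma color_cost_0: "color_cost r 0 = 0"
  by (simp add: color_cost_def)

lemma color_cost_less: "color_cost r c < r div 2"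
  using half_pos by (simp add: color_cost_def)

lemma color_cost_mod: "color_cost r (c mod r) = color_cost r c"
proof -
  have "c mod r mod (r div 2) = c mod (r div 2)"
    by (metis r_eq dvd_triv_right mod_mod_cancel)
  then show ?thesis
    unfolding color_cost_def by (metis mod_mult_left_eq)
qed

lemma color_cost_add_half: "color_cost r (c + r div 2) = color_cost r c"
  by (simp add: color_cost_def add_mult_distrib)

text \<open>The factor \<open>(r div 2 + 1) div 2\<close> is the inverse of 2 modulo the odd number
  \<open>r div 2\<close>, so adding 2 to a color raises its cost cyclically by 1.\<close>

lemma color_cost_add_2: "color_cost r (c + 2) = (color_cost r c + 1) mod (r div 2)"
proof -
  have "2 * ((r div 2 + 1) div 2) = r div 2 + 1"
    using odd_half by simp
  then have "(c + 2) * ((r div 2 + 1) div 2) = c * ((r div 2 + 1) div 2) + 1 + r div 2"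
    unfolding add_mult_distrib by linarith
  then show ?thesis
    unfolding color_cost_def by (simp only: mod_add_self2 mod_add_left_eq)
qed

text \<open>The factor in the cost is a unit modulo \<open>r div 2\<close>, so cost 0 means
  divisibility by \<open>r div 2\<close>, which has only two multiples below
  \<open>r\<close>.\<close>

lemma color_cost_eq_0_iff:
  assumes "c < r"
  shows "color_cost r c = 0 \<longleftrightarrow> c = 0 \<or> c = r div 2"
proof -
  have "2 * ((r div 2 + 1) div 2) = r div 2 + 1"
    using odd_half by simp
  then have "coprime ((r div 2 + 1) div 2) (r div 2)"
    by (metis coprime_add_one_left coprime_mult_left_iff)
  then have "color_cost r c = 0 \<longleftrightarrow> r div 2 dvd c"
    by (simp add: color_cost_def mod_eq_0_iff_dvd coprime_commute coprime_dvd_mult_left_iff)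
  also have "\<dots> \<longleftrightarrow> c = 0 \<or> c = r div 2"
  proof
    assume "r div 2 dvd c"
    then obtain k where k: "c = r div 2 * k" by blast
    then have "r div 2 * k < r div 2 * 2"
      using assms r_eq by linarith
    then have "k < 2"
      by simp
    then show "c = 0 \<or> c = r div 2"
      using k by (auto simp: less_2_cases_iff)
  qed auto
  finally show ?thesis .
qed

lemma weighted_length_rotation:
  assumes "g \<in> carrier G"
  shows "weighted_length r n (s_gen n 0 [^]\<^bsub>G\<^esub> k \<otimes>\<^bsub>G\<^esub> g) + color_cost r (fst g 1)
    = weighted_length r n g + color_cost r (fst g 1 + k)"
proof -
  obtain z \<tau> where g: "g = (z, \<tau>)" by fastforce
  show ?thesis
    using weighted_length_recolor[of z \<tau> "(z 1 + k) mod r"] rotation_mult[of z \<tau> k] assms r_ge_2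
    by (simp add: g color_cost_mod)
qed

lemma weighted_length_half_turn:
  assumes "g \<in> carrier G"
  shows "weighted_length r n (half_turn \<otimes>\<^bsub>G\<^esub> g) = weighted_length r n g"
  using weighted_length_rotation[OF assms, of "r div 2"] by (simp add: color_cost_add_half)

section \<open>The length function of the alternating subgroup\<close>

lemma rotation_closed: "s_gen n 0 [^]\<^bsub>G\<^esub> (k :: nat) \<in> carrier G"
  using s_gen_closed[OF n_pos] by (rule nat_pow_closed)

lemma half_turn_half_turn:
  assumes "g \<in> carrier G"
  shows "half_turn \<otimes>\<^bsub>G\<^esub> (half_turn \<otimes>\<^bsub>G\<^esub> g) = g"
proof -
  have "half_turn \<otimes>\<^bsub>G\<^esub> half_turn = s_gen n 0 [^]\<^bsub>G\<^esub> r"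
    unfolding nat_pow_mult[OF s_gen_closed[OF n_pos]] using r_eq by (metis mult_2)
  also have "\<dots> = s_gen n 0 [^]\<^bsub>G\<^esub> (0 :: nat)"
    unfolding rotation_eq mod_self mod_0 ..
  finally show ?thesis
    using assms rotation_closed by (simp flip: m_assoc)
qed

text \<open>\<open>half_turn\<close> recolors position 1 only, and \<open>s_i\<close> with
  \<open>i \<ge> 2\<close> fixes that position.\<close>

lemma swap_half_turn:
  assumes g: "g \<in> carrier G" and i: "2 \<le> i" "i < n"
  shows "s_gen n i \<otimes>\<^bsub>G\<^esub> (half_turn \<otimes>\<^bsub>G\<^esub> g) = half_turn \<otimes>\<^bsub>G\<^esub> (s_gen n i \<otimes>\<^bsub>G\<^esub> g)"
proof -
  obtain z \<tau> where g_eq: "g = (z, \<tau>)" by fastforce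
  have i1: "1 \<le> i" using i by simp
  show ?thesis
    using m_closed[OF rotation_closed g, of "r div 2"] swap_closed[OF g i(2)] g i
    unfolding g_eq rotation_mult[OF g[unfolded g_eq]] swap_mult[OF g[unfolded g_eq] i1 i(2)]
    by (auto simp: swap_mult rotation_mult fun_eq_iff transpose_def)
qed

lemma a_gen_0: "a_gen r n 0 = s_gen n 0 [^]\<^bsub>G\<^esub> (2 :: nat)"
  by (simp add: a_gen_def)

lemma a_gen_pos: "1 \<le> i \<Longrightarrow> a_gen r n i = half_turn \<otimes>\<^bsub>G\<^esub> s_gen n i"
  by (simp add: a_gen_def)

lemma a_gen_closed: "i < n \<Longrightarrow> a_gen r n i \<in> carrier G"
  using rotation_closed s_gen_closed by (simp add: a_gen_def)

lemma a_gen_mult: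
  "g \<in> carrier G \<Longrightarrow> 1 \<le> i \<Longrightarrow> i < n \<Longrightarrow> a_gen r n i \<otimes>\<^bsub>G\<^esub> g = half_turn \<otimes>\<^bsub>G\<^esub> (s_gen n i \<otimes>\<^bsub>G\<^esub> g)"
  using rotation_closed s_gen_closed by (simp add: a_gen_pos m_assoc)

lemma weighted_length_a_gen:
  assumes "g \<in> carrier G" "1 \<le> i" "i < n"
  shows "weighted_length r n (a_gen r n i \<otimes>\<^bsub>G\<^esub> g) = weighted_length r n (s_gen n i \<otimes>\<^bsub>G\<^esub> g)"
  unfolding a_gen_mult[OF assms] by (intro weighted_length_half_turn swap_closed assms)

lemma alt_gens_cases:
  assumes "x \<in> alt_gens r n"
  obtains "x = a_gen r n 0"
  | i where "1 \<le> i" "i < n" "x = a_gen r n i"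
  | "1 < n" "x = inv\<^bsub>G\<^esub> (a_gen r n 1)"
proof -
  consider i where "i < n" "x = a_gen r n i" | "1 < n" "x = inv\<^bsub>G\<^esub> (a_gen r n 1)"
    using assms by (auto simp: alt_gens_def split: if_splits)
  then show ?thesis
  proof cases
    case (1 i)
    then show ?thesis
      using that(1) that(2)[of i] by (cases "i = 0") auto
  qed (rule that(3))
qed

lemma a_gen_in_alt_gens: "i < n \<Longrightarrow> a_gen r n i \<in> alt_gens r n"
  by (auto simp: alt_gens_def)

lemma inv_a_gen_in_alt_gens: "1 < n \<Longrightarrow> inv\<^bsub>G\<^esub> (a_gen r n 1) \<in> alt_gens r n"
  by (simp add: alt_gens_def)

lemma alt_gens_closed: "x \<in> alt_gens r n \<Longrightarrow> x \<in> carrier G"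
  by (erule alt_gens_cases) (simp_all add: a_gen_closed n_pos)

text \<open>This yields the lower bound for \<open>alt_length\<close>: a word of \<open>u\<close>
  generators reaches weighted length at most \<open>u\<close>.\<close>

lemma weighted_length_alt_gens_mult_le:
  assumes x: "x \<in> alt_gens r n" and g: "g \<in> carrier G"
  shows "weighted_length r n (x \<otimes>\<^bsub>G\<^esub> g) \<le> Suc (weighted_length r n g)"
  using x
proof (cases rule: alt_gens_cases)
  case 1
  have "color_cost r (fst g 1 + 2) \<le> color_cost r (fst g 1) + 1"
    unfolding color_cost_add_2 by (rule mod_less_eq_dividend)
  then show ?thesis
    using weighted_length_rotation[OF g, of 2] unfolding 1 a_gen_0 by linarith
next
  case (2 i)
  then show ?thesis
    using weighted_length_a_gen[OF g] weighted_length_swap_cases[OF g, of i] by auto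
next
  case 3
  have a: "a_gen r n 1 \<in> carrier G"
    using 3 by (simp add: a_gen_closed)
  then have xg: "x \<otimes>\<^bsub>G\<^esub> g \<in> carrier G"
    using g 3 by simp
  \<comment> \<open>The inverse generator reduces to \<open>a_1\<close>, now applied to
    \<open>x g\<close>: that step also changes the weighted length by exactly 1.\<close>
  have "a_gen r n 1 \<otimes>\<^bsub>G\<^esub> (x \<otimes>\<^bsub>G\<^esub> g) = g"
    using a g unfolding 3 by (simp flip: m_assoc)
  then show ?thesis
    using weighted_length_a_gen[OF xg, of 1] weighted_length_swap_cases[OF xg, of 1] 3(1) by auto
qed

text \<open>The first key is at least 1 and the keys are strictly increasing integers, so the
  \<open>j\<close>-th is at least \<open>j\<close>. Hence no letter is colored, and a permutation
  that never decreases a number is the identity.\<close>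

lemma increasing_keys_imp_one:
  assumes g: "(z, \<tau>) \<in> carrier G" and z1: "z 1 = 0"
    and less: "\<And>i. 1 \<le> i \<Longrightarrow> i < n \<Longrightarrow> entry_key (z, \<tau>) i < entry_key (z, \<tau>) (Suc i)"
  shows "(z, \<tau>) = \<one>\<^bsub>G\<^esub>"
proof -
  have z: "z \<in> {1..n} \<rightarrow>\<^sub>E {0..<r}" and \<tau>: "\<tau> permutes {1..n}"
    using g by (simp_all add: carrier_iff)
  have key: "int j \<le> entry_key (z, \<tau>) j" if "1 \<le> j" "j \<le> n" for j
    using that
  proof (induction j rule: dec_induct)
    case base
    then show ?case
      using z1 inv_perm_bounds[OF g, of 1] by (simp add: entry_key_def)
  next
    case (step j)
    then show ?case
      using less[of j] by simp
  qed
  have "z j = 0 \<and> j \<le> inv' \<tau> j" if "j \<in> {1..n}" for j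
    using key[of j] that by (auto simp: entry_key_def split: if_splits)
  then have z0: "\<And>j. j \<in> {1..n} \<Longrightarrow> z j = 0" and ge: "\<forall>j\<in>{1..n}. inv' \<tau> j \<ge> j"
    by blast+
  have "inv' \<tau> = id"
    using permutes_natset_ge[OF permutes_inv[OF \<tau>] ge] .
  then have "\<tau> = id"
    using permutes_inv_inv[OF \<tau>] by simp
  moreover have "z = restrict z {1..n}"
    using z by (simp only: PiE_restrict)
  then have "z = (\<lambda>j\<in>{1..n}. 0)"
    using z0 restrict_ext[of "{1..n}" z "\<lambda>j. 0"] by simp
  ultimately show ?thesis
    by (simp add: one_eq)
qed

text \<open>If no adjacent swap and no rotation by \<open>s\<^sub>0\<^sup>2\<close> shortens \<open>g\<close>, the first color has cost 0, so it
  may be reset to 0 by \<open>s\<^sub>0\<^sup>h\<close>. Either this creates a descent at 1, and then \<open>a\<^sub>1\<close> shortens \<open>g\<close>, or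
  all entries are now increasing starting from a positive one.\<close>

lemma alt_gens_descent:
  assumes g: "g \<in> carrier G" and ne: "g \<noteq> \<one>\<^bsub>G\<^esub>" "g \<noteq> half_turn"
  shows "\<exists>x\<in>alt_gens r n. \<exists>g'\<in>carrier G. g = x \<otimes>\<^bsub>G\<^esub> g' \<and> weighted_length r n g = Suc (weighted_length r n g')"
proof -
  obtain z \<tau> where g_eq: "g = (z, \<tau>)" by fastforce
  have z: "z \<in> {1..n} \<rightarrow>\<^sub>E {0..<r}"
    using g by (simp add: g_eq carrier_iff)
  have z1: "z 1 < r"
    using PiE_mem[OF z, of 1] n_pos by simp
  let ?tg = "half_turn \<otimes>\<^bsub>G\<^esub> g"
  have tg: "?tg \<in> carrier G"
    using rotation_closed g by blast
  have tg_eq: "?tg = (z(1 := (z 1 + r div 2) mod r), \<tau>)"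
    using rotation_mult g unfolding g_eq by blast
  consider (swap) i where "1 \<le> i" "i < n" "entry_key g (Suc i) < entry_key g i"
    | (rotation) "color_cost r (z 1) \<noteq> 0"
    | (turn_swap) "1 < n" "entry_key ?tg (Suc 1) < entry_key ?tg 1"
    | (increasing) "\<And>i. 1 \<le> i \<Longrightarrow> i < n \<Longrightarrow> entry_key g i \<le> entry_key g (Suc i)"
        "color_cost r (z 1) = 0" "1 < n \<Longrightarrow> entry_key ?tg 1 \<le> entry_key ?tg (Suc 1)"
    by (meson not_le)
  then show ?thesis
  proof cases
    case swap
    have W: "weighted_length r n g = Suc (weighted_length r n (a_gen r n i \<otimes>\<^bsub>G\<^esub> g))"
      using weighted_length_swap_descent[OF g swap] weighted_length_a_gen[OF g swap(1,2)] by simp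
    have a: "a_gen r n i \<in> carrier G"
      using swap by (simp add: a_gen_closed)
    show ?thesis
    \<comment> \<open>For \<open>i \<ge> 2\<close> the factors of \<open>a_i\<close> commute and
      \<open>a_i\<close> is an involution. For \<open>i = 1\<close> they need not commute, and
      returning to \<open>g\<close> takes the inverse generator.\<close>
    proof (cases "i = 1")
      case True
      have "g = inv\<^bsub>G\<^esub> (a_gen r n 1) \<otimes>\<^bsub>G\<^esub> (a_gen r n 1 \<otimes>\<^bsub>G\<^esub> g)"
        using a g unfolding True by (simp flip: m_assoc)
      then show ?thesis
        using W a g swap inv_a_gen_in_alt_gens m_closed unfolding True by metis
    next
      case False
      then have "2 \<le> i"
        using swap by simp
      then have "a_gen r n i \<otimes>\<^bsub>G\<^esub> (a_gen r n i \<otimes>\<^bsub>G\<^esub> g) = g"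
        using a_gen_mult swap(1,2) swap_half_turn swap_swap half_turn_half_turn g swap_closed
          m_closed[OF rotation_closed] by simp
      then show ?thesis
        using W a g swap a_gen_in_alt_gens m_closed by metis
    qed
  next
    case rotation
    have a: "a_gen r n 0 \<in> carrier G"
      using n_pos by (rule a_gen_closed)
    define g' where "g' = inv\<^bsub>G\<^esub> (a_gen r n 0) \<otimes>\<^bsub>G\<^esub> g"
    have g': "g' \<in> carrier G"
      using a g by (simp add: g'_def)
    have gg': "g = a_gen r n 0 \<otimes>\<^bsub>G\<^esub> g'"
      using a g by (simp add: g'_def flip: m_assoc)
    have "fst g 1 = (fst g' 1 + 2) mod r"
      using g' rotation_mult[of "fst g'" "snd g'" 2] unfolding gg' a_gen_0 by simp
    \<comment> \<open>The cost of the first color of \<open>g\<close> is nonzero, so the cyclic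
      increment from \<open>g'\<close> to \<open>g\<close> does not wrap around and is a genuine
      increase by 1.\<close>
    then have "(color_cost r (fst g' 1) + 1) mod (r div 2) \<noteq> 0"
      using rotation by (simp only: g_eq fst_conv color_cost_mod color_cost_add_2 not_False_eq_True)
    then have "color_cost r (fst g' 1 + 2) = color_cost r (fst g' 1) + 1"
      using color_cost_less[of "fst g' 1"] unfolding color_cost_add_2
      by (metis Suc_eq_plus1 Suc_lessI mod_less mod_self)
    then have "weighted_length r n g = Suc (weighted_length r n g')"
      using weighted_length_rotation[OF g', of 2] unfolding gg' a_gen_0 by simp
    then show ?thesis
      using g' gg' a_gen_in_alt_gens[OF n_pos] by blast
  next
    case turn_swap
    \<comment> \<open>With \<open>t\<close> for \<open>half_turn\<close>,
      \<open>a_1 (s_1 t g) = t s_1 s_1 t g = g\<close>.\<close>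
    let ?g' = "s_gen n 1 \<otimes>\<^bsub>G\<^esub> ?tg"
    have g': "?g' \<in> carrier G"
      using swap_closed[OF tg turn_swap(1)] .
    have "a_gen r n 1 \<otimes>\<^bsub>G\<^esub> ?g' = g"
      using a_gen_mult[OF g' _ turn_swap(1)] swap_swap[OF tg _ turn_swap(1)] half_turn_half_turn[OF g] by simp
    moreover have "weighted_length r n g = Suc (weighted_length r n ?g')"
      using weighted_length_swap_descent[OF tg _ turn_swap] weighted_length_half_turn[OF g] by simp
    ultimately show ?thesis
      using g' a_gen_in_alt_gens[OF turn_swap(1)] by metis
  next
    case increasing
    have keys_g: "entry_key g i < entry_key g (Suc i)" if "1 \<le> i" "i < n" for i
      using increasing(1)[OF that] entry_key_neq[of z \<tau> i "Suc i"] g that by (simp add: g_eq order_less_le)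
    have keys_tg: "entry_key ?tg i < entry_key ?tg (Suc i)" if i: "1 \<le> i" "i < n" for i
    proof (cases "i = 1")
      case True
      then show ?thesis
        using increasing(3) entry_key_neq[OF tg[unfolded tg_eq], of 1 "Suc 1"] i
        unfolding tg_eq by (simp add: order_less_le)
    next
      case False
      then show ?thesis
        using keys_g[OF i] i unfolding tg_eq unfolding g_eq by (simp add: entry_key_def)
    qed
    have "z 1 = 0 \<or> z 1 = r div 2"
      using increasing(2) color_cost_eq_0_iff[OF z1] by simp
    then show ?thesis
    proof
      assume "z 1 = 0"
      then show ?thesis
        using increasing_keys_imp_one g keys_g ne(1) unfolding g_eq by blast
    next
      assume "z 1 = r div 2"
      then have "(z(1 := (z 1 + r div 2) mod r)) 1 = 0"
        unfolding fun_upd_same using r_eq by (metis mod_self mult_2)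
      then have "?tg = \<one>\<^bsub>G\<^esub>"
        using increasing_keys_imp_one tg keys_tg unfolding tg_eq by blast
      then have "g = half_turn"
        using half_turn_half_turn[OF g] r_one[OF rotation_closed] by simp
      then show ?thesis
        using ne(2) by blast
    qed
  qed
qed

lemma weighted_length_one: "weighted_length r n \<one>\<^bsub>G\<^esub> = 0"
proof -
  have "inversions xs = 0" if "sorted xs" for xs :: "int list"
    using that by (induction xs) (auto simp: filter_empty_conv not_less)
  moreover have "map (entry_key \<one>\<^bsub>G\<^esub>) [1..<Suc n] = map int [1..<Suc n]"
    by (intro map_cong refl) (auto simp: one_eq entry_key_def)
  moreover have "sorted (map int [1..<Suc n])"
    by (simp add: sorted_map sorted_wrt_upt[THEN sorted_wrt_mono_rel[rotated]] del: upt_Suc)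
  ultimately have "inversions (map (entry_key \<one>\<^bsub>G\<^esub>) [1..<Suc n]) = 0"
    by presburger
  then show ?thesis
    by (simp add: weighted_length_def one_eq color_cost_0)
qed

section \<open>The sign character\<close>

text \<open>Stated for any such \<open>\<chi>\<close>, because it serves both the explicit character
  and its competitors in the uniqueness proof. As \<open>r div 2\<close> is odd,
  \<open>half_turn\<close> has sign -1, which cancels the sign of \<open>s_i\<close> in
  \<open>a_i\<close>.\<close>

lemma sign_char_values:
  assumes \<chi>: "\<chi> \<in> hom G sign_img" and s: "\<And>i. i < n \<Longrightarrow> \<chi> (s_gen n i) = -1"
  shows "\<chi> \<one>\<^bsub>G\<^esub> = 1" "\<chi> half_turn = -1" "x \<in> alt_gens r n \<Longrightarrow> \<chi> x = 1"
proof -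
  have mult: "\<chi> (x \<otimes>\<^bsub>G\<^esub> y) = \<chi> x * \<chi> y" if "x \<in> carrier G" "y \<in> carrier G" for x y
    using hom_mult[OF \<chi> that] by (simp add: sign_img_def)
  \<comment> \<open>The value at the identity is its own square, which excludes -1.\<close>
  have "\<chi> \<one>\<^bsub>G\<^esub> \<in> {-1, 1}"
    using hom_in_carrier[OF \<chi> one_closed] by (simp add: sign_img_def)
  then show one: "\<chi> \<one>\<^bsub>G\<^esub> = 1"
    using mult[OF one_closed one_closed] by auto
  have pow: "\<chi> (s_gen n 0 [^]\<^bsub>G\<^esub> (k :: nat)) = (-1) ^ k" for k
    by (induction k) (simp_all add: one mult rotation_closed s_gen_closed n_pos s)
  then show half: "\<chi> half_turn = -1"
    using odd_half by simp
  have a: "\<chi> (a_gen r n i) = 1" if "1 \<le> i" "i < n" for i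
    using that by (simp add: a_gen_pos mult half s rotation_closed s_gen_closed)
  show "\<chi> x = 1" if "x \<in> alt_gens r n"
    using that
  proof (cases rule: alt_gens_cases)
    case 1
    then show ?thesis by (simp add: a_gen_0 pow)
  next
    case 2
    then show ?thesis by (simp add: a)
  next
    case 3
    then have "\<chi> (a_gen r n 1) * \<chi> x = 1"
      using mult[of "a_gen r n 1" x] a_gen_closed one by simp
    then show ?thesis
      using 3 a[of 1] by simp
  qed
qed

text \<open>Reduction modulo the even number \<open>r\<close> preserves parity, and the permutation
  only reorders the second color sum.\<close>

lemma color_sign_mult:
  assumes g: "g \<in> carrier G" and g': "g' \<in> carrier G"
  shows "color_sign n (g \<otimes>\<^bsub>G\<^esub> g') = color_sign n g * color_sign n g'"
proof -
  obtain z \<tau> z' \<tau>' where eq: "g = (z, \<tau>)" "g' = (z', \<tau>')"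
    by (metis surj_pair)
  have \<tau>: "\<tau> permutes {1..n}" "\<tau>' permutes {1..n}"
    using g g' by (auto simp: eq carrier_iff)
  have "even r"
    using r_eq by (metis dvd_triv_left)
  then have "(-1) ^ (c mod r) = ((-1) ^ c :: int)" for c
    using dvd_mod_iff[of 2 r c] by (cases "even c") auto
  then have "(-1) ^ (\<Sum>j=1..n. (z j + z' (inv' \<tau> j)) mod r)
      = ((-1) ^ (\<Sum>j=1..n. z j + z' (inv' \<tau> j)) :: int)"
    by (simp add: power_sum)
  also have "(\<Sum>j=1..n. z j + z' (inv' \<tau> j)) = (\<Sum>j=1..n. z j) + (\<Sum>j=1..n. z' j)"
    using sum.permute[OF permutes_inv[OF \<tau>(1)], of z'] by (simp add: sum.distrib comp_def)
  finally have "(-1) ^ (\<Sum>j=1..n. (z j + z' (inv' \<tau> j)) mod r)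
      = ((-1) ^ (\<Sum>j=1..n. z j) * (-1) ^ (\<Sum>j=1..n. z' j) :: int)"
    by (simp only: power_add)
  moreover have "sign (\<tau> \<circ> \<tau>') = sign \<tau> * sign \<tau>'"
    using \<tau> by (intro sign_compose permutes_imp_permutation[OF finite_atLeastAtMost])
  ultimately show ?thesis
    by (simp add: eq color_sign_def mult_eq)
qed

lemma color_sign_hom: "color_sign n \<in> hom G sign_img"
proof -
  have "color_sign n g \<in> {-1, 1}" for g
    by (cases g) (simp add: color_sign_def sign_def minus_one_power_iff)
  then show ?thesis
    by (auto simp: hom_def sign_img_def color_sign_mult)
qed

lemma color_sign_s_gen:
  assumes "i < n"
  shows "color_sign n (s_gen n i) = -1"
proof -
  have "(\<Sum>k=1..n. if k = 1 then 1 else 0 :: nat) = 1"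
    using n_pos by simp
  then show ?thesis
    by (simp add: color_sign_def s_gen_def sign_swap_id)
qed

text \<open>Uniqueness of the character: by descent, every element is a product of elements of
  \<open>alt_gens\<close>, on which both characters are 1, and possibly \<open>s\<^sub>0\<^sup>h\<close>, on which both are -1.\<close>

lemma hom_eq_color_sign:
  assumes \<chi>: "\<chi> \<in> hom G sign_img" "\<And>i. i < n \<Longrightarrow> \<chi> (s_gen n i) = -1" and g: "g \<in> carrier G"
  shows "\<chi> g = color_sign n g"
  using g
proof (induction "weighted_length r n g" arbitrary: g rule: less_induct)
  case less
  note char_values = sign_char_values[OF \<chi>] sign_char_values[OF color_sign_hom color_sign_s_gen]
  show ?case
  proof (cases "g = \<one>\<^bsub>G\<^esub> \<or> g = half_turn")
    case True
    then show ?thesis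
      using char_values by auto
  next
    case False
    then obtain x g' where x: "x \<in> alt_gens r n" "g' \<in> carrier G" "g = x \<otimes>\<^bsub>G\<^esub> g'"
      and "weighted_length r n g' < weighted_length r n g"
      using alt_gens_descent[OF less.prems] by fastforce
    then have "\<chi> g' = color_sign n g'"
      using less.hyps by blast
    then show ?thesis
      using x char_values hom_mult[OF \<chi>(1)] hom_mult[OF color_sign_hom] alt_gens_closed by metis
  qed
qed

lemma sign_char_eq: "sign_char r n = restrict (color_sign n) (carrier G)"
  unfolding sign_char_def
proof (rule the_equality)
  show "restrict (color_sign n) (carrier G) \<in> hom G sign_img \<and>
      restrict (color_sign n) (carrier G) \<in> extensional (carrier G) \<and>
      (\<forall>i<n. restrict (color_sign n) (carrier G) (s_gen n i) = - 1)"
    using color_sign_hom color_sign_s_gen s_gen_closed by (auto simp: hom_def)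
next
  fix \<chi>
  assume "\<chi> \<in> hom G sign_img \<and> \<chi> \<in> extensional (carrier G) \<and> (\<forall>i<n. \<chi> (s_gen n i) = - 1)"
  then show "\<chi> = restrict (color_sign n) (carrier G)"
    using hom_eq_color_sign by (intro extensionalityI[of _ "carrier G"]) auto
qed

lemma alt_colored_perms_eq: "alt_colored_perms r n = {g \<in> carrier G. color_sign n g = 1}"
  by (auto simp: alt_colored_perms_def kernel_def sign_char_eq sign_img_def)

text \<open>Each descent strips a generator of sign 1 and so stays in the subgroup. It can only stop
  at the identity, since \<open>half_turn\<close> has sign -1.\<close>

lemma exists_word_of_weighted_length:
  assumes "g \<in> alt_colored_perms r n"
  shows "\<exists>ws. length ws = weighted_length r n g \<and> set ws \<subseteq> alt_gens r n
    \<and> foldr (\<otimes>\<^bsub>G\<^esub>) ws \<one>\<^bsub>G\<^esub> = g"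
  using assms
proof (induction "weighted_length r n g" arbitrary: g rule: less_induct)
  case less
  have g: "g \<in> carrier G" "color_sign n g = 1"
    using less.prems by (auto simp: alt_colored_perms_eq)
  note char_values = sign_char_values[OF color_sign_hom color_sign_s_gen]
  show ?case
  proof (cases "g = \<one>\<^bsub>G\<^esub>")
    case True
    then show ?thesis
      by (intro exI[of _ "[]"]) (simp add: weighted_length_one)
  next
    case False
    moreover have "g \<noteq> half_turn"
      using g char_values(2) by auto
    ultimately obtain x g' where x: "x \<in> alt_gens r n" "g' \<in> carrier G" "g = x \<otimes>\<^bsub>G\<^esub> g'"
      and W: "weighted_length r n g = Suc (weighted_length r n g')"
      using alt_gens_descent[OF g(1)] by blast
    have "color_sign n g' = 1"
      using g(2) x char_values(3) color_sign_mult alt_gens_closed by auto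
    then obtain ws where "length ws = weighted_length r n g'" "set ws \<subseteq> alt_gens r n"
        "foldr (\<otimes>\<^bsub>G\<^esub>) ws \<one>\<^bsub>G\<^esub> = g'"
      using less.hyps[of g'] W x(2) by (auto simp: alt_colored_perms_eq)
    then show ?thesis
      using x W by (intro exI[of _ "x # ws"]) simp
  qed
qed

lemma weighted_length_foldr_le:
  assumes "set ws \<subseteq> alt_gens r n"
  shows "foldr (\<otimes>\<^bsub>G\<^esub>) ws \<one>\<^bsub>G\<^esub> \<in> carrier G
    \<and> weighted_length r n (foldr (\<otimes>\<^bsub>G\<^esub>) ws \<one>\<^bsub>G\<^esub>) \<le> length ws"
  using assms
proof (induction ws)
  case Nil
  then show ?case by (simp add: weighted_length_one)
next
  case (Cons x ws)
  then show ?case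
    using weighted_length_alt_gens_mult_le[of x "foldr (\<otimes>\<^bsub>G\<^esub>) ws \<one>\<^bsub>G\<^esub>"] alt_gens_closed by fastforce
qed

lemma alt_length_eq:
  assumes "g \<in> alt_colored_perms r n"
  shows "alt_length r n g = weighted_length r n g"
  unfolding alt_length_def
proof (rule Least_equality)
  fix u
  assume "\<exists>ws. length ws = u \<and> set ws \<subseteq> alt_gens r n \<and> foldr (\<otimes>\<^bsub>G\<^esub>) ws \<one>\<^bsub>G\<^esub> = g"
  then show "weighted_length r n g \<le> u"
    using weighted_length_foldr_le by blast
qed (rule exists_word_of_weighted_length[OF assms])

section \<open>Generating functions\<close>

text \<open>Index colors by letters instead of positions. The costs then depend on the coloring
  \<open>w\<close> alone, and for each fixed \<open>w\<close> the words contribute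
  \<open>q_fact n\<close>, whatever the signs of the keys.\<close>

lemma sum_carrier_weighted_length:
  "(\<Sum>g\<in>carrier G. q_var ^ weighted_length r n g) =
    q_fact n * (\<Prod>j=1..n. \<Sum>c<r. q_var ^ ((if c = 0 then 0 else j - 1) + color_cost r c))"
proof -
  let ?Z = "{1..n} \<rightarrow>\<^sub>E {0..<r}" and ?P = "{\<sigma>. \<sigma> permutes {1..n}}"
  define cost where "cost w j = (if w j = 0 then 0 else j - 1) + color_cost r (w j)"
    for w :: "nat \<Rightarrow> nat" and j :: nat
  define key where "key w j = (if w j = 0 then int j else - int j)" for w :: "nat \<Rightarrow> nat" and j
  have compose: "z \<circ> \<sigma> \<in> ?Z" if "z \<in> ?Z" "\<sigma> permutes {1..n}" for z \<sigma>
  proof (rule PiE_I)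
    fix j assume "j \<in> {1..n}"
    then have "\<sigma> j \<in> {1..n}"
      using that(2) by (simp only: permutes_in_image)
    then show "(z \<circ> \<sigma>) j \<in> {0..<r}"
      using PiE_mem[OF that(1)] by simp
  next
    fix j assume j: "j \<notin> {1..n}"
    then show "(z \<circ> \<sigma>) j = undefined"
      using PiE_arb[OF that(1) j] permutes_not_in[OF that(2) j] by simp
  qed
  \<comment> \<open>The substitution is \<open>\<sigma> = inv' \<tau>\<close>, the word itself, and
    \<open>w = z \<circ> \<tau>\<close>, the color of each letter.\<close>
  have "(\<Sum>g\<in>carrier G. q_var ^ weighted_length r n g)
      = (\<Sum>(w, \<sigma>)\<in>?Z \<times> ?P. q_var ^ weighted_length r n (w \<circ> \<sigma>, inv' \<sigma>))"
    by (rule sum.reindex_bij_witness[where i = "\<lambda>(w, \<sigma>). (w \<circ> \<sigma>, inv' \<sigma>)" and j = "\<lambda>(z, \<tau>). (z \<circ> \<tau>, inv' \<tau>)"])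
      (clarsimp simp: carrier_iff permutes_inv permutes_inv_inv comp_assoc permutes_inv_o
        compose[unfolded One_nat_def] simp del: atLeastAtMost_iff)+
  also have "\<dots> = (\<Sum>(w, \<sigma>)\<in>?Z \<times> ?P.
      (\<Prod>j=1..n. q_var ^ cost w j) * q_var ^ inversions (map (key w \<circ> \<sigma>) [1..<Suc n]))"
  proof (intro sum.cong refl, clarify)
    fix w \<sigma>
    assume \<sigma>: "\<sigma> permutes {1..n}"
    have "entry_key (w \<circ> \<sigma>, inv' \<sigma>) = key w \<circ> \<sigma>"
      by (simp add: entry_key_def key_def permutes_inv_inv[OF \<sigma>] fun_eq_iff)
    moreover have "(\<Sum>j=1..n. F (\<sigma> j)) = (\<Sum>j=1..n. F j)" for F :: "nat \<Rightarrow> nat"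
      using sum.permute[OF \<sigma>, of F] by (simp add: comp_def)
    note this[of "\<lambda>j. if w j = 0 then 0 else j - 1"] this[of "\<lambda>j. color_cost r (w j)"]
    ultimately have "weighted_length r n (w \<circ> \<sigma>, inv' \<sigma>)
        = inversions (map (key w \<circ> \<sigma>) [1..<Suc n]) + (\<Sum>j=1..n. cost w j)"
      unfolding weighted_length_def fst_conv snd_conv permutes_inv_inv[OF \<sigma>] comp_apply cost_def sum.distrib
      by simp
    then show "q_var ^ weighted_length r n (w \<circ> \<sigma>, inv' \<sigma>)
        = (\<Prod>j=1..n. q_var ^ cost w j) * q_var ^ inversions (map (key w \<circ> \<sigma>) [1..<Suc n])"
      by (simp only: power_add power_sum mult.commute)
  qed
  also have "\<dots> = (\<Sum>w\<in>?Z. (\<Prod>j=1..n. q_var ^ cost w j) *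
      (\<Sum>\<sigma>\<in>?P. q_var ^ inversions (map (key w \<circ> \<sigma>) [1..<Suc n])))"
    by (simp only: sum.cartesian_product[symmetric] sum_distrib_left)
  also have "\<dots> = (\<Sum>w\<in>?Z. (\<Prod>j=1..n. q_var ^ cost w j) * q_fact n)"
  proof (intro sum.cong refl arg_cong2[where f = "(*)"])
    fix w
    have inj: "inj_on (key w) {1..n}"
      by (auto simp: inj_on_def key_def split: if_splits)
    have "(\<Sum>\<sigma>\<in>?P. q_var ^ inversions (map (key w \<circ> \<sigma>) [1..<Suc n]))
        = (\<Sum>xs\<in>permutations_of_set (key w ` {1..n}). q_var ^ inversions xs)"
      by (rule sum.reindex_bij_betw[OF bij_betw_permutes_permutations_of_set[OF inj]])
    also have "\<dots> = q_fact n"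
      using inj by (simp add: inversions_generating_function card_image)
    finally show "(\<Sum>\<sigma>\<in>?P. q_var ^ inversions (map (key w \<circ> \<sigma>) [1..<Suc n])) = q_fact n" .
  qed
  also have "\<dots> = q_fact n * (\<Sum>w\<in>?Z. \<Prod>j=1..n. q_var ^ cost w j)"
    by (simp only: sum_distrib_left mult.commute)
  \<comment> \<open>Colors of different letters are chosen independently, so the sum over colorings
    factors.\<close>
  also have "(\<Sum>w\<in>?Z. \<Prod>j=1..n. q_var ^ cost w j)
      = (\<Prod>j=1..n. \<Sum>c\<in>{0..<r}. q_var ^ ((if c = 0 then 0 else j - 1) + color_cost r c))"
    unfolding cost_def by (rule prod_sum_PiE[symmetric]) simp_all
  finally show ?thesis
    by (simp only: atLeast0LessThan)
qed

text \<open>Each cost below \<open>r div 2\<close> is taken twice, at \<open>c\<close> and at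
  \<open>c + r div 2\<close>. One of the two zeros is the color 0, which alone does not carry the
  factor \<open>q_var ^ k\<close>.\<close>

lemma sum_color_cost:
  "(\<Sum>c<r. q_var ^ ((if c = 0 then 0 else k) + color_cost r c)) =
    1 + q_var ^ k * (1 + 2 * (\<Sum>m=1..r div 2 - 1. q_var ^ m))"
proof -
  let ?h = "r div 2" and ?S = "\<Sum>m=1..r div 2 - 1. q_var ^ m"
  have inj: "inj_on (color_cost r) {..<?h}"
  proof (rule inj_onI)
    fix c d assume cd: "c \<in> {..<?h}" "d \<in> {..<?h}" "color_cost r c = color_cost r d"
    \<comment> \<open>Doubling modulo \<open>r div 2\<close> recovers a color below
      \<open>r div 2\<close> from its cost.\<close>
    have double: "2 * color_cost r e mod ?h = e" if "e < ?h" for e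
    proof -
      have "2 * ((?h + 1) div 2) = ?h + 1"
        using odd_half by simp
      then have "2 * (e * ((?h + 1) div 2)) = e + e * ?h"
        by (metis add.commute mult.left_commute mult.right_neutral distrib_left)
      then have "2 * color_cost r e mod ?h = (e + e * ?h) mod ?h"
        unfolding color_cost_def by (metis mod_mult_right_eq)
      then show ?thesis
        using that by simp
    qed
    show "c = d"
      using double[of c] double[of d] cd by (metis lessThan_iff)
  qed
  moreover have "color_cost r ` {..<?h} \<subseteq> {..<?h}"
    using color_cost_less by blast
  ultimately have "bij_betw (color_cost r) {..<?h} {..<?h}"
    by (simp add: bij_betw_def endo_inj_surj)
  then have low: "(\<Sum>c<?h. q_var ^ color_cost r c) = (\<Sum>m<?h. q_var ^ m)"
    by (rule sum.reindex_bij_betw)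
  have "{..<?h} = insert 0 {1..?h - 1}"
    using half_pos by auto
  then have S: "(\<Sum>m<?h. q_var ^ m) = 1 + ?S"
    by simp
  have "{..<r} = {..<?h} \<union> {?h..<?h + ?h}"
    using r_eq by auto
  then have "(\<Sum>c<r. q_var ^ color_cost r c)
      = (\<Sum>c<?h. q_var ^ color_cost r c) + (\<Sum>c\<in>{?h..<?h + ?h}. q_var ^ color_cost r c)"
    by (simp add: sum.union_disjoint ivl_disj_int)
  also have "(\<Sum>c\<in>{?h..<?h + ?h}. q_var ^ color_cost r c) = (\<Sum>c<?h. q_var ^ color_cost r c)"
    using sum.shift_bounds_nat_ivl[of "\<lambda>c. q_var ^ color_cost r c" 0 ?h ?h]
    by (simp add: color_cost_add_half atLeast0LessThan)
  finally have total: "(\<Sum>c<r. q_var ^ color_cost r c) = 2 * (1 + ?S)"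
    by (simp only: low S mult_2)
  have split: "{..<r} = insert 0 {1..<r}"
    using r_ge_2 by auto
  then have "1 + (\<Sum>c\<in>{1..<r}. q_var ^ color_cost r c) = 2 * (1 + ?S)"
    using total by (simp add: color_cost_0)
  then have tail: "(\<Sum>c\<in>{1..<r}. q_var ^ color_cost r c) = 1 + 2 * ?S"
    by (simp add: algebra_simps)
  have "(\<Sum>c<r. q_var ^ ((if c = 0 then 0 else k) + color_cost r c))
      = 1 + (\<Sum>c\<in>{1..<r}. q_var ^ ((if c = 0 then 0 else k) + color_cost r c))"
    unfolding split by (simp add: color_cost_0)
  also have "(\<Sum>c\<in>{1..<r}. q_var ^ ((if c = 0 then 0 else k) + color_cost r c))
      = q_var ^ k * (\<Sum>c\<in>{1..<r}. q_var ^ color_cost r c)"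
    unfolding sum_distrib_left by (intro sum.cong refl) (simp add: power_add)
  finally show ?thesis
    by (simp only: tail)
qed

lemma sum_carrier_eq_twice_alt:
  "(\<Sum>g\<in>carrier G. q_var ^ weighted_length r n g)
    = 2 * (\<Sum>g\<in>alt_colored_perms r n. q_var ^ weighted_length r n g)"
proof -
  let ?A = "alt_colored_perms r n" and ?f = "\<lambda>g. q_var ^ weighted_length r n g"
  have sign: "color_sign n (half_turn \<otimes>\<^bsub>G\<^esub> g) = - color_sign n g" if "g \<in> carrier G" for g
    using color_sign_mult[OF rotation_closed that]
      sign_char_values(2)[OF color_sign_hom color_sign_s_gen] by simp
  have "color_sign n g = 1 \<or> color_sign n g = -1" if "g \<in> carrier G" for g
    using hom_in_carrier[OF color_sign_hom that] by (auto simp: sign_img_def)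
  then have carrier: "carrier G = ?A \<union> (carrier G - ?A)" "carrier G - ?A = {g \<in> carrier G. color_sign n g = -1}"
    by (auto simp: alt_colored_perms_eq)
  have "sum ?f (carrier G) = sum ?f ?A + sum ?f (carrier G - ?A)"
    using finite_carrier sum.subset_diff[of ?A "carrier G" ?f] by (simp add: alt_colored_perms_eq add.commute)
  also have "sum ?f (carrier G - ?A) = sum ?f ?A"
    unfolding carrier(2)
    by (rule sum.reindex_bij_witness[where i = "\<lambda>g. half_turn \<otimes>\<^bsub>G\<^esub> g" and j = "\<lambda>g. half_turn \<otimes>\<^bsub>G\<^esub> g"])
      (auto simp: alt_colored_perms_eq sign half_turn_half_turn weighted_length_half_turn rotation_closed)
  finally show ?thesis
    by (simp only: mult_2)
qed

end

theorem corollary5p8: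
  fixes r n :: nat
  assumes "0 < r" and "0 < n" and "r mod 4 = 2"
  shows "(\<Sum>\<pi>\<in>alt_colored_perms r n. q_var ^ alt_length r n \<pi>) =
    smult (1 / 2) (q_fact n *
      (\<Prod>j=1..n. 1 + q_var ^ (j - 1) * (1 + 2 * (\<Sum>m=1..r div 2 - 1. q_var ^ m))))"
proof -
  interpret alternating_colored_perms r n
    using assms by unfold_locales
  have "(\<Sum>\<pi>\<in>alt_colored_perms r n. q_var ^ alt_length r n \<pi>)
      = (\<Sum>\<pi>\<in>alt_colored_perms r n. q_var ^ weighted_length r n \<pi>)"
    by (simp add: alt_length_eq)
  also have "\<dots> = smult (1 / 2) (2 * (\<Sum>\<pi>\<in>alt_colored_perms r n. q_var ^ weighted_length r n \<pi>))"
    by (simp add: numeral_poly)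
  finally show ?thesis
    unfolding sum_carrier_eq_twice_alt[symmetric] sum_carrier_weighted_length sum_color_cost .
qed

end
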